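(* Let $n>0$ be an integer and let $P=\{f_1,\ldots,f_n\}$ be a family of continuous functions $f_i\colon[0,1]\to[0,1]$. Let $T_P\colon[0,1]\to[0,1]^n$ be $T_P(t)=(f_1(t),\ldots,f_n(t))$. The following are equivalent: (i) $P$ is a pseudo-triangular basis; (ii) $P$ is a $2$-overlapping Ruspini partition, and each $f_i\in P$ is strongly normal, min-convex, and strictly min-convex on its support; (iii) the map $T_P$ is injective and its range $T_P([0,1])$ is a Hamiltonian path on the $1$-skeleton of the fundamental simplex $\Delta_n$, i.e. there is a permutation $\pi$ of $\{1,\ldots,n\}$ with $T_P([0,1])=\bigcup_{i=1}^{n-1}\mathrm{conv}\{e_{\pi(i)},e_{\pi(i+1)}\}$.
   Context: Here $e_1,\ldots,e_n$ is the standard basis of $\mathbb{R}^n$, $\Delta_n=\mathrm{conv}\{e_1,\ldots,e_n\}$, and $\mathrm{conv}$ denotes convex hull. $P$ is a Ruspini partition if $\sum_{i=1}^n f_i(x)=1$ for all $x\in[0,1]$. $P$ is $2$-overlapping if for all $x\in[0,1]$ and all pairwise distinct indices $i_1,i_2,i_3$ one has $\min\{f_{i_1}(x),f_{i_2}(x),f_{i_3}(x)\}=0$. A function $f\colon[0,1]\to[0,1]$ is strongly normal if there is exactly one $x\in[0,1]$ with $f(x)=1$. It is min-convex if $f(\lambda x+(1-\lambda)y)\ge\min(f(x),f(y))$ for all $x,y,\lambda\in[0,1]$. Its support is $S_f=\{x\in[0,1]: f(x)>0\}$. It is strictly min-convex on its support if $f(\lambda x+(1-\lambda)y)>\min(f(x),f(y))$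 for all $x<y$ in $[0,1]$ with $[x,y]\subseteq S_f$ and all $\lambda\in(0,1)$. $P$ is a pseudo-triangular basis if there exist reals $0=t_1<t_2<\cdots<t_n=1$ such that, after a suitable permutation of the indices of the $f_i$, for each $i=1,\ldots,n-1$: (a) $f_i(t_i)=1$ and $f_i(t_{i+1})=0$; (b) $f_j(x)=0$ for all $x\in[t_i,t_{i+1}]$ and all $j\neq i,i+1$; (c) $f_{i+1}(x)=1-f_i(x)$ for all $x\in[t_i,t_{i+1}]$; (d) $f_i$ and $f_{i+1}$ restricted to $[t_i,t_{i+1}]$ are bijections onto $[0,1]$. *)

theory Defs
  imports "HOL-Analysis.Analysis"
begin

text \<open>
  A family \<open>f\<^sub>1, \<dots>, f\<^sub>n\<close> is a function \<open>f :: 'n \<Rightarrow> real \<Rightarrow> real\<close> on a finite index type with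
  \<open>n = CARD('n)\<close>, so that \<open>\<real>\<^sup>n\<close> is \<open>real ^ 'n\<close>. A rearrangement of the indices is a bijection
  from \<open>{1..n}\<close> to \<open>'n\<close>. Functions on \<open>[0,1]\<close> are total functions on the reals; every notion
  below only inspects their values on \<open>{0..1}\<close>.
\<close>

definition ruspini_partition :: "('n::finite \<Rightarrow> real \<Rightarrow> real) \<Rightarrow> bool" where
  "ruspini_partition f \<longleftrightarrow> (\<forall>x\<in>{0..1}. (\<Sum>i\<in>UNIV. f i x) = 1)"

definition two_overlapping :: "('n::finite \<Rightarrow> real \<Rightarrow> real) \<Rightarrow> bool" where
  "two_overlapping f \<longleftrightarrow>
     (\<forall>x\<in>{0..1}. \<forall>i j k. i \<noteq> j \<and> i \<noteq> k \<and> j \<noteq> k \<longrightarrow> Min {f i x, f j x, f k x} = 0)"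

definition strongly_normal :: "(real \<Rightarrow> real) \<Rightarrow> bool" where
  "strongly_normal g \<longleftrightarrow> (\<exists>!x. x \<in> {0..1} \<and> g x = 1)"

definition min_convex :: "(real \<Rightarrow> real) \<Rightarrow> bool" where
  "min_convex g \<longleftrightarrow>
     (\<forall>x\<in>{0..1}. \<forall>y\<in>{0..1}. \<forall>l\<in>{0..1}. g (l * x + (1 - l) * y) \<ge> min (g x) (g y))"

definition support01 :: "(real \<Rightarrow> real) \<Rightarrow> real set" where
  "support01 g = {x \<in> {0..1}. g x > 0}"

definition strictly_min_convex_on_support :: "(real \<Rightarrow> real) \<Rightarrow> bool" where
  "strictly_min_convex_on_support g \<longleftrightarrow>
     (\<forall>x\<in>{0..1}. \<forall>y\<in>{0..1}. x < y \<and> {x..y} \<subseteq> support01 g \<longrightarrow>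
        (\<forall>l\<in>{0<..<1}. g (l * x + (1 - l) * y) > min (g x) (g y)))"

definition pseudo_triangular_basis :: "('n::finite \<Rightarrow> real \<Rightarrow> real) \<Rightarrow> bool" where
  "pseudo_triangular_basis f \<longleftrightarrow>
     (\<exists>(t :: nat \<Rightarrow> real) (p :: nat \<Rightarrow> 'n).
        t 1 = 0 \<and> t CARD('n) = 1 \<and> strict_mono_on {1..CARD('n)} t \<and>
        bij_betw p {1..CARD('n)} UNIV \<and>
        (\<forall>i\<in>{1..<CARD('n)}.
           f (p i) (t i) = 1 \<and> f (p i) (t (i + 1)) = 0 \<and>
           (\<forall>x\<in>{t i..t (i + 1)}. \<forall>j. j \<noteq> p i \<and> j \<noteq> p (i + 1) \<longrightarrow> f j x = 0) \<and>
           (\<forall>x\<in>{t i..t (i + 1)}. f (p (i + 1)) x = 1 - f (p i) x) \<and>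
           bij_betw (f (p i)) {t i..t (i + 1)} {0..1} \<and>
           bij_betw (f (p (i + 1))) {t i..t (i + 1)} {0..1}))"

definition T_map :: "('n::finite \<Rightarrow> real \<Rightarrow> real) \<Rightarrow> real \<Rightarrow> real ^ 'n" where
  "T_map f x = (\<chi> i. f i x)"

text \<open>
  The vertices \<open>e\<^sub>i\<close> of the fundamental simplex are the vectors \<open>axis i 1\<close>. Since any two of them
  span an edge, a Hamiltonian path on its 1-skeleton is given by an arbitrary ordering of the
  vertices.
\<close>

definition hamiltonian_path :: "(real ^ 'n::finite) set \<Rightarrow> bool" where
  "hamiltonian_path S \<longleftrightarrow>
     (\<exists>p :: nat \<Rightarrow> 'n. bij_betw p {1..CARD('n)} UNIV \<and>
        S = (\<Union>i\<in>{1..<CARD('n)}. convex hull {axis (p i) 1, axis (p (i + 1)) 1}))"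

end

theory Submission
  imports Defs
begin

text \<open>
  All three conditions say that, up to the order of the indices, the \<open>f\<^sub>k\<close> are the hat functions
  on \<open>[1,n]\<close> with integer nodes, composed with an increasing bijection \<open>\<phi>\<close> from \<open>[0,1]\<close> onto
  \<open>[1,n]\<close>. From a pseudo-triangular basis or a Hamiltonian path one recovers
  \<open>\<phi> = \<Sum>k. k \<cdot> f\<^sub>k\<close>. In the order-theoretic condition, sorting the peaks of the \<open>f\<^sub>i\<close>
  yields the nodes of a pseudo-triangular basis: min-convexity forces \<open>f\<^sub>j\<close> to vanish beyond every
  other peak, and makes \<open>f\<^sub>i\<close> monotone between adjacent peaks.
\<close>

definition hat :: "nat \<Rightarrow> real \<Rightarrow> real" where
  "hat k y = max 0 (1 - \<bar>y - real k\<bar>)"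

text \<open>A strictly increasing map onto an interval is a homeomorphism, so \<open>\<phi>\<close>
  is a change of parameter. The order \<open>p\<close> matches positions \<open>1..n\<close> with
  indices, and node \<open>k\<close> of the hats belongs to \<open>f (p k)\<close>.\<close>

definition hat_reparametrization ::
    "('n::finite \<Rightarrow> real \<Rightarrow> real) \<Rightarrow> (nat \<Rightarrow> 'n) \<Rightarrow> (real \<Rightarrow> real) \<Rightarrow> bool" where
  "hat_reparametrization f p \<phi> \<longleftrightarrow>
     bij_betw p {1..CARD('n)} UNIV \<and>
     strict_mono_on {0..1} \<phi> \<and> \<phi> ` {0..1} = {1..real CARD('n)} \<and>
     (\<forall>k\<in>{1..CARD('n)}. \<forall>x\<in>{0..1}. f (p k) x = hat k (\<phi> x))"

text \<open>For \<open>y\<close> in \<open>[1,n]\<close> this is the polygonal path through the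
  vertices in the order \<open>p\<close>. It reaches the \<open>k\<close>-th vertex at time
  \<open>k\<close> and runs along each edge in unit time.\<close>

definition hat_curve :: "(nat \<Rightarrow> 'n::finite) \<Rightarrow> real \<Rightarrow> real ^ 'n" where
  "hat_curve p y = (\<Sum>k\<in>{1..CARD('n)}. hat k y *\<^sub>R axis (p k) 1)"

section \<open>Nodes, consecutive intervals and sorted enumerations\<close>

lemma mem_consecutive_interval:
  fixes t :: "nat \<Rightarrow> 'a::linorder"
  assumes "1 < n" "t 1 \<le> x" "x \<le> t n"
  obtains i where "i \<in> {1..<n}" "x \<in> {t i..t (i + 1)}"
proof -
  have "\<exists>i\<in>{1..<n}. x \<in> {t i..t (i + 1)}"
    using assms
  proof (induction n)
    case (Suc m)
    show ?case
    proof (cases "m = 1 \<or> t m \<le> x")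
      case True
      then show ?thesis using Suc.prems by (intro bexI[of _ m]) auto
    next
      case False
      then have "\<exists>i\<in>{1..<m}. x \<in> {t i..t (i + 1)}"
        using Suc by auto
      then show ?thesis by auto
    qed
  qed simp
  then show ?thesis using that by blast
qed

text \<open>Neighbouring intervals share a node, so values on its two sides are compared through the
  value at the node itself.\<close>

lemma strict_mono_on_pieces:
  fixes t :: "nat \<Rightarrow> 'a::linorder" and g :: "'a \<Rightarrow> 'b::order"
  assumes "1 < n" "strict_mono_on {1..n} t"
    and "\<And>i. i \<in> {1..<n} \<Longrightarrow> strict_mono_on {t i..t (i + 1)} g"
  shows "strict_mono_on {t 1..t n} g"
  using assms
proof (induction n)
  case (Suc m)
  show ?case
  proof (cases "m = 1")
    case True
    then show ?thesis using Suc.prems(3)[of 1] by simp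
  next
    case False
    then have m: "1 < m" using Suc.prems by simp
    have sm: "strict_mono_on {1..m} t"
      using Suc.prems(2) by (rule monotone_on_subset) auto
    have left: "strict_mono_on {t 1..t m} g"
      using Suc.IH[OF m sm] Suc.prems(3) by auto
    have right: "strict_mono_on {t m..t (Suc m)} g"
      using Suc.prems(3)[of m] m by simp
    have tm: "t 1 \<le> t m" "t m \<le> t (Suc m)"
      using strict_mono_onD[OF Suc.prems(2), of 1 m]
        strict_mono_onD[OF Suc.prems(2), of m "Suc m"] m by auto
    show ?thesis
    proof (rule strict_mono_onI)
      fix x y
      assume xy: "x \<in> {t 1..t (Suc m)}" "y \<in> {t 1..t (Suc m)}" "x < y"
      consider "y \<le> t m" | "t m \<le> x" | "x < t m" "t m < y" by force
      then show "g x < g y"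
      proof cases
        case 1
        then show ?thesis using strict_mono_onD[OF left, of x y] xy by auto
      next
        case 2
        then show ?thesis using strict_mono_onD[OF right, of x y] xy by auto
      next
        case 3
        then have "g x < g (t m)" "g (t m) < g y"
          using strict_mono_onD[OF left, of x "t m"] strict_mono_onD[OF right, of "t m" y] xy tm
          by auto
        then show ?thesis by (rule less_trans)
      qed
    qed
  qed
qed simp

lemma ex_strict_mono_enumeration:
  fixes A :: "'a::linorder set"
  assumes "finite A"
  obtains t where "bij_betw t {1..card A} A" "strict_mono_on {1..card A} t"
proof
  define xs where "xs = sorted_list_of_set A"
  have len: "length xs = card A" and set: "set xs = A" and sorted: "sorted_wrt (<) xs"
    using assms by (auto simp: xs_def)
  \<comment> \<open>Lists are indexed from 0 and nodes from 1, hence the shift.\<close>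
  define t where "t k = xs ! (k - 1)" for k
  show mono: "strict_mono_on {1..card A} t"
    by (rule strict_mono_onI) (auto simp: t_def len intro!: sorted_wrt_nth_less[OF sorted])
  have "t ` {1..card A} = A"
  proof (intro equalityI subsetI)
    fix a assume "a \<in> A"
    then obtain i where "i < card A" "a = xs ! i"
      using set len by (metis in_set_conv_nth)
    then show "a \<in> t ` {1..card A}"
      by (intro image_eqI[of _ _ "Suc i"]) (auto simp: t_def)
  qed (use set len nth_mem[of _ xs] in \<open>auto simp: t_def\<close>)
  then show "bij_betw t {1..card A} A"
    using strict_mono_on_imp_inj_on[OF mono] by (simp add: bij_betw_def)
qed

section \<open>Hat functions with integer nodes\<close>

lemma hat_eq_1_iff: "hat k y = 1 \<longleftrightarrow> y = real k"
  by (auto simp: hat_def max_def)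

lemma hat_nonneg: "0 \<le> hat k y"
  by (simp add: hat_def)

lemma hat_eq_0: "1 \<le> \<bar>y - real k\<bar> \<Longrightarrow> hat k y = 0"
  by (simp add: hat_def)

lemma hat_left_node: "y \<in> {real i..real (i + 1)} \<Longrightarrow> hat i y = real (i + 1) - y"
  by (auto simp: hat_def)

lemma hat_right_node: "y \<in> {real i..real (i + 1)} \<Longrightarrow> hat (i + 1) y = y - real i"
  by (auto simp: hat_def)

lemma hat_eq_0_between:
  assumes "y \<in> {real i..real (i + 1)}" "k \<noteq> i" "k \<noteq> i + 1"
  shows "hat k y = 0"
proof (rule hat_eq_0)
  consider "k + 1 \<le> i" | "i + 2 \<le> k" using assms(2,3) by linarith
  then show "1 \<le> \<bar>y - real k\<bar>"
  proof cases
    case 1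
    then have "real k + 1 \<le> real i" by linarith
    then show ?thesis using assms(1) by auto
  next
    case 2
    then have "real i + 2 \<le> real k" by linarith
    then show ?thesis using assms(1) by auto
  qed
qed

text \<open>Only two hats survive between adjacent nodes, so the sum interpolates \<open>g\<close>
  linearly. Taking \<open>g\<close> to be the constant 1, the index, and the vertices gives the
  partition of unity, the recovery of \<open>y\<close>, and the polygonal curve.\<close>

lemma sum_hat:
  fixes g :: "nat \<Rightarrow> 'a::real_vector"
  assumes "i \<in> {1..<n}" "y \<in> {real i..real (i + 1)}"
  shows "(\<Sum>k\<in>{1..n}. hat k y *\<^sub>R g k) = (real (i + 1) - y) *\<^sub>R g i + (y - real i) *\<^sub>R g (i + 1)"
proof -
  have "(\<Sum>k\<in>{1..n}. hat k y *\<^sub>R g k) = (\<Sum>k\<in>{i, i + 1}. hat k y *\<^sub>R g k)"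
    using assms(1) hat_eq_0_between[OF assms(2)] by (intro sum.mono_neutral_right) auto
  then show ?thesis
    using hat_left_node[OF assms(2)] hat_right_node[OF assms(2)] by simp
qed

lemma mem_node_interval:
  assumes "1 < n" "y \<in> {1..real n}"
  obtains i where "i \<in> {1..<n}" "y \<in> {real i..real (i + 1)}"
proof (rule mem_consecutive_interval[of n real y])
  show "1 < n" "real 1 \<le> y" "y \<le> real n" using assms by auto
qed (rule that)

lemma sum_hat_eq_1:
  assumes "1 < n" "y \<in> {1..real n}"
  shows "(\<Sum>k\<in>{1..n}. hat k y) = 1"
proof -
  obtain i where i: "i \<in> {1..<n}" "y \<in> {real i..real (i + 1)}"
    using mem_node_interval[OF assms] .
  show ?thesis using sum_hat[OF i, of "\<lambda>_. 1::real"] by simp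
qed

text \<open>Linear interpolation of the value \<open>k\<close> at each node \<open>k\<close> is the
  identity. This is what recovers a parameter from the hat values alone.\<close>

lemma sum_index_hat:
  assumes "1 < n" "y \<in> {1..real n}"
  shows "(\<Sum>k\<in>{1..n}. real k * hat k y) = y"
proof -
  obtain i where i: "i \<in> {1..<n}" "y \<in> {real i..real (i + 1)}"
    using mem_node_interval[OF assms] .
  show ?thesis using sum_hat[OF i, of real] by (simp add: algebra_simps)
qed

lemma hat_ge_min: "a \<le> z \<Longrightarrow> z \<le> b \<Longrightarrow> min (hat k a) (hat k b) \<le> hat k z"
  unfolding hat_def by linarith

text \<open>Positivity at \<open>a\<close> and \<open>b\<close> keeps both off the flat part, so the
  hat there is 1 minus the distance to \<open>k\<close>. A point strictly between them is strictly
  closer to \<open>k\<close> than at least one of them.\<close>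

lemma hat_greater_min:
  assumes "a < z" "z < b" "0 < hat k a" "0 < hat k b"
  shows "min (hat k a) (hat k b) < hat k z"
proof -
  have "hat k a = 1 - \<bar>a - real k\<bar>" "hat k b = 1 - \<bar>b - real k\<bar>" "1 - \<bar>z - real k\<bar> \<le> hat k z"
    using assms(3,4) by (auto simp: hat_def max_def split: if_splits)
  moreover have "\<bar>z - real k\<bar> < \<bar>a - real k\<bar> \<or> \<bar>z - real k\<bar> < \<bar>b - real k\<bar>"
    using assms(1,2) by linarith
  ultimately show ?thesis unfolding min_less_iff_disj by linarith
qed

text \<open>Integers at distance less than 1 from a common point differ pairwise by at most 1, which
  three distinct integers cannot do.\<close>

lemma hat_overlap:
  assumes "0 < hat i y" "0 < hat j y" "0 < hat k y"
  shows "i = j \<or> i = k \<or> j = k"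
proof -
  have *: "\<bar>y - real i\<bar> < 1" "\<bar>y - real j\<bar> < 1" "\<bar>y - real k\<bar> < 1"
    using assms by (auto simp: hat_def max_def split: if_splits)
  have "\<bar>real i - real j\<bar> < 2" "\<bar>real i - real k\<bar> < 2" "\<bar>real j - real k\<bar> < 2"
    using * by linarith+
  then show ?thesis by linarith
qed

section \<open>The polygonal curve through the vertices\<close>

lemma hat_curve_nth:
  fixes p :: "nat \<Rightarrow> 'n::finite"
  assumes "bij_betw p {1..CARD('n)} UNIV" "k \<in> {1..CARD('n)}"
  shows "hat_curve p y $ p k = hat k y"
proof -
  have "(hat j y *\<^sub>R axis (p j) 1) $ p k = (if j = k then hat j y else 0)"
    if "j \<in> {1..CARD('n)}" for j
    using inj_on_eq_iff[OF bij_betw_imp_inj_on[OF assms(1)] that assms(2)] by (auto simp: axis_def)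
  then have "hat_curve p y $ p k = (\<Sum>j\<in>{1..CARD('n)}. if j = k then hat j y else 0)"
    unfolding hat_curve_def sum_component by (rule sum.cong[OF refl])
  then show ?thesis using assms(2) by simp
qed

text \<open>While \<open>y\<close> runs through \<open>[i,i+1]\<close>, the curve interpolates
  linearly between the two ends of the \<open>i\<close>-th edge and so traverses exactly this
  edge.\<close>

lemma hat_curve_image:
  fixes p :: "nat \<Rightarrow> 'n::finite"
  assumes "1 < CARD('n)"
  shows "hat_curve p ` {1..real CARD('n)} =
    (\<Union>i\<in>{1..<CARD('n)}. convex hull {axis (p i) 1, axis (p (i + 1)) 1})"
proof (intro equalityI subsetI)
  fix v assume "v \<in> hat_curve p ` {1..real CARD('n)}"
  then obtain y where y: "y \<in> {1..real CARD('n)}" "v = hat_curve p y" by blast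
  obtain i where i: "i \<in> {1..<CARD('n)}" "y \<in> {real i..real (i + 1)}"
    using mem_node_interval[OF assms y(1)] .
  have "v = (1 - (y - real i)) *\<^sub>R axis (p i) 1 + (y - real i) *\<^sub>R axis (p (i + 1)) 1"
    using sum_hat[OF i, of "\<lambda>k. axis (p k) (1::real)"] y(2) by (simp add: hat_curve_def algebra_simps)
  then have "v \<in> closed_segment (axis (p i) 1) (axis (p (i + 1)) 1)"
    using i(2) by (auto simp: in_segment intro!: exI[of _ "y - real i"])
  then show "v \<in> (\<Union>i\<in>{1..<CARD('n)}. convex hull {axis (p i) 1, axis (p (i + 1)) 1})"
    using i(1) by (auto simp: segment_convex_hull)
next
  fix v
  assume "v \<in> (\<Union>i\<in>{1..<CARD('n)}. convex hull {axis (p i) 1, axis (p (i + 1)) (1::real)})"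
  then obtain i where i: "i \<in> {1..<CARD('n)}"
    and v: "v \<in> closed_segment (axis (p i) 1) (axis (p (i + 1)) 1)"
    by (auto simp: segment_convex_hull)
  obtain u where u: "0 \<le> u" "u \<le> 1" "v = (1 - u) *\<^sub>R axis (p i) 1 + u *\<^sub>R axis (p (i + 1)) 1"
    using v by (auto simp: in_segment)
  \<comment> \<open>The point at fraction \<open>u\<close> of the \<open>i\<close>-th edge is
    reached at time \<open>i + u\<close>.\<close>
  have y: "real i + u \<in> {real i..real (i + 1)}" using u by auto
  have "real (i + 1) - (real i + u) = 1 - u" "real i + u - real i = u" by simp_all
  then have "hat_curve p (real i + u) = v"
    unfolding hat_curve_def u(3) sum_hat[OF i y] by (simp only:)
  moreover have "real i + u \<in> {1..real CARD('n)}"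
  proof -
    have "1 \<le> real i" "real i + 1 \<le> real CARD('n)" using i by auto
    then show ?thesis using u(1,2) by auto
  qed
  ultimately show "v \<in> hat_curve p ` {1..real CARD('n)}" by blast
qed

lemma T_map_eq_hat_curve_iff:
  fixes f :: "'n::finite \<Rightarrow> real \<Rightarrow> real"
  assumes "bij_betw p {1..CARD('n)} UNIV"
  shows "T_map f x = hat_curve p y \<longleftrightarrow> (\<forall>k\<in>{1..CARD('n)}. f (p k) x = hat k y)"
proof -
  have "T_map f x = hat_curve p y \<longleftrightarrow> (\<forall>j\<in>p ` {1..CARD('n)}. f j x = hat_curve p y $ j)"
    using assms by (simp add: vec_eq_iff T_map_def bij_betw_def)
  then show ?thesis
    using hat_curve_nth[OF assms] by auto
qed

section \<open>Consequences of a hat reparametrization\<close>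

lemma hat_reparametrization_card:
  fixes f :: "'n::finite \<Rightarrow> real \<Rightarrow> real"
  assumes "hat_reparametrization f p \<phi>"
  shows "1 < CARD('n)"
proof -
  \<comment> \<open>For \<open>n = 1\<close> the interval \<open>[1,n]\<close> is a single point and
    cannot contain two distinct values.\<close>
  have "\<phi> 0 < \<phi> 1"
    using assms by (auto simp: hat_reparametrization_def intro: strict_mono_onD)
  moreover have "\<phi> 0 \<in> {1..real CARD('n)}" "\<phi> 1 \<in> {1..real CARD('n)}"
    using assms unfolding hat_reparametrization_def by (metis atLeastAtMost_iff imageI order_refl zero_le_one)+
  ultimately have "1 < real CARD('n)" by auto
  then show ?thesis by simp
qed

text \<open>The nodes are the preimages of the integers under \<open>\<phi>\<close>. On the
  \<open>i\<close>-th piece \<open>\<phi>\<close> is a bijection onto \<open>[i,i+1]\<close>, where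
  the two surviving hats are the affine bijections \<open>i + 1 - y\<close> and \<open>y - i\<close>
  onto \<open>[0,1]\<close>.\<close>

lemma hat_reparametrization_imp_pseudo_triangular:
  fixes f :: "'n::finite \<Rightarrow> real \<Rightarrow> real"
  assumes "hat_reparametrization f p \<phi>"
  shows "pseudo_triangular_basis f"
proof -
  let ?n = "CARD('n)"
  have p: "bij_betw p {1..?n} UNIV" and mono: "strict_mono_on {0..1} \<phi>"
    and img: "\<phi> ` {0..1} = {1..real ?n}"
    and fp: "\<And>k x. k \<in> {1..?n} \<Longrightarrow> x \<in> {0..1} \<Longrightarrow> f (p k) x = hat k (\<phi> x)"
    using assms by (auto simp: hat_reparametrization_def)
  have n: "1 < ?n" using hat_reparametrization_card[OF assms] .
  have le_iff: "\<phi> x \<le> \<phi> y \<longleftrightarrow> x \<le> y" if "x \<in> {0..1}" "y \<in> {0..1}" for x y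
    using strict_mono_onD[OF mono, of y x] strict_mono_on_leD[OF mono, of x y] that by force
  define t where "t k = inv_into {0..1} \<phi> (real k)" for k
  have t: "t k \<in> {0..1}" "\<phi> (t k) = real k" if "k \<in> {1..?n}" for k
  proof -
    have "real k \<in> \<phi> ` {0..1}" using that img by auto
    then show "t k \<in> {0..1}" "\<phi> (t k) = real k"
      unfolding t_def by (rule inv_into_into, rule f_inv_into_f)
  qed
  have t_mono: "strict_mono_on {1..?n} t"
  proof (rule strict_mono_onI)
    fix i j :: nat assume ij: "i \<in> {1..?n}" "j \<in> {1..?n}" "i < j"
    then have "\<not> \<phi> (t j) \<le> \<phi> (t i)" using t(2) by simp
    then show "t i < t j" using le_iff t(1) ij by auto
  qed
  have ends: "\<phi> 0 \<in> {1..real ?n}" "\<phi> 1 \<in> {1..real ?n}"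
    using img by (metis atLeastAtMost_iff imageI order_refl zero_le_one)+
  \<comment> \<open>The extreme values 1 and \<open>n\<close> are taken at \<open>t 1\<close> and
    \<open>t ?n\<close>. Since \<open>\<phi>\<close> reflects the order, these nodes must be the
    ends of \<open>[0,1]\<close>.\<close>
  have "\<phi> (t 1) \<le> \<phi> 0" "\<phi> 1 \<le> \<phi> (t ?n)"
    using t(2)[of 1] t(2)[of ?n] ends n by auto
  then have t_ends: "t 1 = 0" "t ?n = 1"
    using le_iff[of "t 1" 0] le_iff[of 1 "t ?n"] t(1)[of 1] t(1)[of ?n] n by auto
  have piece: "\<phi> x \<in> {real i..real (i + 1)} \<longleftrightarrow> x \<in> {t i..t (i + 1)}"
    if "i \<in> {1..<?n}" "x \<in> {0..1}" for i x
    using le_iff[of "t i" x] le_iff[of x "t (i + 1)"] t[of i] t[of "i + 1"] that by auto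
  have sub: "{t i..t (i + 1)} \<subseteq> {0..1}" if "i \<in> {1..<?n}" for i
    using t(1)[of i] t(1)[of "i + 1"] that by auto
  have phi_bij: "bij_betw \<phi> {t i..t (i + 1)} {real i..real (i + 1)}" if i: "i \<in> {1..<?n}" for i
    unfolding bij_betw_def
  proof (intro conjI equalityI subsetI)
    show "inj_on \<phi> {t i..t (i + 1)}"
      using strict_mono_on_imp_inj_on[OF mono] sub[OF i] by (rule inj_on_subset)
  next
    fix y assume y: "y \<in> {real i..real (i + 1)}"
    moreover have "{real i..real (i + 1)} \<subseteq> \<phi> ` {0..1}" unfolding img using i by auto
    ultimately obtain x where "x \<in> {0..1}" "\<phi> x = y" by blast
    then show "y \<in> \<phi> ` {t i..t (i + 1)}" using piece[OF i, of x] y by blast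
  next
    fix y assume "y \<in> \<phi> ` {t i..t (i + 1)}"
    then show "y \<in> {real i..real (i + 1)}" using piece[OF i] sub[OF i] by blast
  qed
  have main: "f (p i) (t i) = 1 \<and> f (p i) (t (i + 1)) = 0 \<and>
           (\<forall>x\<in>{t i..t (i + 1)}. \<forall>j. j \<noteq> p i \<and> j \<noteq> p (i + 1) \<longrightarrow> f j x = 0) \<and>
           (\<forall>x\<in>{t i..t (i + 1)}. f (p (i + 1)) x = 1 - f (p i) x) \<and>
           bij_betw (f (p i)) {t i..t (i + 1)} {0..1} \<and>
           bij_betw (f (p (i + 1))) {t i..t (i + 1)} {0..1}" if i: "i \<in> {1..<?n}" for i
  proof -
    have in01: "x \<in> {0..1}" "\<phi> x \<in> {real i..real (i + 1)}" if "x \<in> {t i..t (i + 1)}" for x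
      using that piece[OF i] sub[OF i] by blast+
    have L: "f (p i) x = real (i + 1) - \<phi> x" if "x \<in> {t i..t (i + 1)}" for x
      using fp[of i x] hat_left_node[OF in01(2)[OF that]] in01(1)[OF that] i by auto
    have R: "f (p (i + 1)) x = \<phi> x - real i" if "x \<in> {t i..t (i + 1)}" for x
      using fp[of "i + 1" x] hat_right_node[OF in01(2)[OF that]] in01(1)[OF that] i by auto
    have tt: "t i \<in> {t i..t (i + 1)}" "t (i + 1) \<in> {t i..t (i + 1)}"
      using strict_mono_onD[OF t_mono, of i "i + 1"] i by auto
    have "f j x = 0" if "x \<in> {t i..t (i + 1)}" "j \<noteq> p i" "j \<noteq> p (i + 1)" for j x
    proof -
      obtain k where k: "k \<in> {1..?n}" "j = p k"
        using p by (metis UNIV_I bij_betw_imp_surj_on imageE)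
      then have "k \<noteq> i" "k \<noteq> i + 1" using that by auto
      then show ?thesis
        using fp[OF k(1) in01(1)[OF that(1)]] k(2) hat_eq_0_between[OF in01(2)[OF that(1)]] by simp
    qed
    moreover have "bij_betw ((\<lambda>y. real (i + 1) - y) \<circ> \<phi>) {t i..t (i + 1)} {0..1}"
      by (rule bij_betw_trans[OF phi_bij[OF i]])
        (rule bij_betw_byWitness[where f' = "\<lambda>y. real (i + 1) - y"], auto)
    then have "bij_betw (f (p i)) {t i..t (i + 1)} {0..1}"
      by (rule iffD1[OF bij_betw_cong, rotated]) (simp add: L)
    moreover have "bij_betw ((\<lambda>y. y - real i) \<circ> \<phi>) {t i..t (i + 1)} {0..1}"
      by (rule bij_betw_trans[OF phi_bij[OF i]])
        (rule bij_betw_byWitness[where f' = "\<lambda>y. y + real i"], auto)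
    then have "bij_betw (f (p (i + 1))) {t i..t (i + 1)} {0..1}"
      by (rule iffD1[OF bij_betw_cong, rotated]) (simp add: R[simplified])
    moreover have "f (p i) (t i) = 1" "f (p i) (t (i + 1)) = 0"
      using L tt t(2)[of i] t(2)[of "i + 1"] i by auto
    ultimately show ?thesis using L R by auto
  qed
  show ?thesis
    unfolding pseudo_triangular_basis_def
    using t_ends t_mono p main by (intro exI[of _ t] exI[of _ p]) blast
qed

lemma hat_reparametrization_imp_ruspini:
  fixes f :: "'n::finite \<Rightarrow> real \<Rightarrow> real"
  assumes H: "hat_reparametrization f p \<phi>"
  shows "ruspini_partition f"
  unfolding ruspini_partition_def
proof
  fix x :: real assume x: "x \<in> {0..1}"
  have p: "bij_betw p {1..CARD('n)} UNIV" and "\<phi> x \<in> {1..real CARD('n)}"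
    using H x by (auto simp: hat_reparametrization_def)
  then have "(\<Sum>k\<in>{1..CARD('n)}. hat k (\<phi> x)) = 1"
    using sum_hat_eq_1[OF hat_reparametrization_card[OF H]] by blast
  moreover have "(\<Sum>k\<in>{1..CARD('n)}. hat k (\<phi> x)) = (\<Sum>k\<in>{1..CARD('n)}. f (p k) x)"
    using H x by (intro sum.cong) (auto simp: hat_reparametrization_def)
  ultimately show "(\<Sum>i\<in>UNIV. f i x) = 1"
    using sum.reindex_bij_betw[OF p, of "\<lambda>i. f i x"] by simp
qed

lemma hat_reparametrization_imp_two_overlapping:
  fixes f :: "'n::finite \<Rightarrow> real \<Rightarrow> real"
  assumes H: "hat_reparametrization f p \<phi>"
  shows "two_overlapping f"
  unfolding two_overlapping_def
proof (intro ballI allI impI)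
  fix x :: real and i j k :: 'n
  assume x: "x \<in> {0..1}" and distinct: "i \<noteq> j \<and> i \<noteq> k \<and> j \<noteq> k"
  have "\<exists>a. i = p a \<and> f i x = hat a (\<phi> x)" for i
  proof -
    obtain a where "a \<in> {1..CARD('n)}" "i = p a"
      using H unfolding hat_reparametrization_def by (metis UNIV_I bij_betw_imp_surj_on imageE)
    then show ?thesis using H x by (auto simp: hat_reparametrization_def)
  qed
  then obtain a b c where *: "i = p a" "j = p b" "k = p c"
    "f i x = hat a (\<phi> x)" "f j x = hat b (\<phi> x)" "f k x = hat c (\<phi> x)"
    by metis
  \<comment> \<open>Distinct indices sit at distinct positions \<open>a\<close>, \<open>b\<close>,
    \<open>c\<close>, and three different hats are never positive at once.\<close>
  then have "hat a (\<phi> x) = 0 \<or> hat b (\<phi> x) = 0 \<or> hat c (\<phi> x) = 0"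
    using distinct hat_overlap[of a "\<phi> x" b c] hat_nonneg[of _ "\<phi> x"] by (metis less_le)
  then show "Min {f i x, f j x, f k x} = 0"
    using * hat_nonneg[of a "\<phi> x"] hat_nonneg[of b "\<phi> x"] hat_nonneg[of c "\<phi> x"]
    by (auto simp: min_def)
qed

text \<open>Both convexity notions compare the value at a point between \<open>x\<close> and
  \<open>y\<close> with the values at \<open>x\<close> and \<open>y\<close>. An increasing
  \<open>\<phi>\<close> preserves betweenness, so they carry over from the hats.\<close>

lemma hat_reparametrization_imp_convexity:
  fixes f :: "'n::finite \<Rightarrow> real \<Rightarrow> real"
  assumes H: "hat_reparametrization f p \<phi>"
  shows "strongly_normal (f i)" "min_convex (f i)" "strictly_min_convex_on_support (f i)"
proof -
  have mono: "strict_mono_on {0..1} \<phi>" and img: "\<phi> ` {0..1} = {1..real CARD('n)}"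
    using H by (auto simp: hat_reparametrization_def)
  obtain k where k: "k \<in> {1..CARD('n)}" "i = p k"
    using H unfolding hat_reparametrization_def
    by (metis UNIV_I bij_betw_imp_surj_on imageE)
  then have f: "f i x = hat k (\<phi> x)" if "x \<in> {0..1}" for x
    using H that by (auto simp: hat_reparametrization_def)
  have "real k \<in> \<phi> ` {0..1}" using img k(1) by auto
  then obtain x where x: "x \<in> {0..1}" "\<phi> x = real k" by auto
  show "strongly_normal (f i)"
    unfolding strongly_normal_def
  proof (rule ex1I[of _ x])
    show "x \<in> {0..1} \<and> f i x = 1" using f x hat_eq_1_iff by auto
    show "y = x" if "y \<in> {0..1} \<and> f i y = 1" for y
      using that f x hat_eq_1_iff[of k] strict_mono_on_eqD[OF mono, of y x] by auto
  qed
  show "min_convex (f i)"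
    unfolding min_convex_def
  proof (intro ballI)
    fix x y l :: real
    assume xyl: "x \<in> {0..1}" "y \<in> {0..1}" "l \<in> {0..1}"
    define z where "z = l * x + (1 - l) * y"
    have "z \<in> closed_segment x y"
      \<comment> \<open>The definition puts the weight \<open>l\<close> on the first point, whereas
        \<open>in_segment\<close> parametrizes by the weight of the second; hence the witness
        \<open>1 - l\<close>.\<close>
      using xyl by (auto simp: in_segment z_def intro!: exI[of _ "1 - l"])
    then have z: "x \<le> z \<and> z \<le> y \<or> y \<le> z \<and> z \<le> x"
      by (auto simp: closed_segment_eq_real_ivl split: if_splits)
    then have "z \<in> {0..1}" using xyl by auto
    moreover from this have "\<phi> x \<le> \<phi> z \<and> \<phi> z \<le> \<phi> y \<or> \<phi> y \<le> \<phi> z \<and> \<phi> z \<le> \<phi> x"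
      using z xyl strict_mono_on_leD[OF mono] by blast
    ultimately show "min (f i x) (f i y) \<le> f i (l * x + (1 - l) * y)"
      unfolding z_def[symmetric]
      using hat_ge_min[of "\<phi> x" "\<phi> z" "\<phi> y" k] hat_ge_min[of "\<phi> y" "\<phi> z" "\<phi> x" k] f xyl
      by (auto simp: min.commute)
  qed
  show "strictly_min_convex_on_support (f i)"
    unfolding strictly_min_convex_on_support_def
  proof (intro ballI impI)
    fix x y l :: real
    assume xyl: "x \<in> {0..1}" "y \<in> {0..1}" "l \<in> {0<..<1}"
      and supp: "x < y \<and> {x..y} \<subseteq> support01 (f i)"
    define z where "z = l * x + (1 - l) * y"
    have "z \<in> open_segment x y"
      using xyl supp by (auto simp: in_segment z_def intro!: exI[of _ "1 - l"])
    then have z: "x < z" "z < y"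
      using supp by (auto simp: open_segment_eq_real_ivl split: if_splits)
    have "x \<in> support01 (f i)" "y \<in> support01 (f i)" using supp by auto
    then have "0 < hat k (\<phi> x)" "0 < hat k (\<phi> y)"
      using f by (auto simp: support01_def)
    moreover have "z \<in> {0..1}" using z xyl by auto
    moreover have "\<phi> x < \<phi> z" "\<phi> z < \<phi> y"
      using strict_mono_onD[OF mono] z xyl \<open>z \<in> {0..1}\<close> by blast+
    ultimately show "min (f i x) (f i y) < f i (l * x + (1 - l) * y)"
      unfolding z_def[symmetric] using hat_greater_min[of "\<phi> x" "\<phi> z" "\<phi> y" k] f xyl by simp
  qed
qed

text \<open>On \<open>[0,1]\<close> the map \<open>T_map f\<close> is \<open>hat_curve p\<close>
  after \<open>\<phi>\<close>. Coordinates of the curve determine its parameter through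
  \<open>sum_index_hat\<close>, which gives injectivity.\<close>

lemma hat_reparametrization_imp_hamiltonian:
  fixes f :: "'n::finite \<Rightarrow> real \<Rightarrow> real"
  assumes H: "hat_reparametrization f p \<phi>"
  shows "inj_on (T_map f) {0..1}" "hamiltonian_path (T_map f ` {0..1})"
proof -
  have p: "bij_betw p {1..CARD('n)} UNIV" and mono: "strict_mono_on {0..1} \<phi>"
    and img: "\<phi> ` {0..1} = {1..real CARD('n)}"
    using H by (auto simp: hat_reparametrization_def)
  have T: "T_map f x = hat_curve p (\<phi> x)" if "x \<in> {0..1}" for x
    using H that by (simp add: T_map_eq_hat_curve_iff[OF p] hat_reparametrization_def)
  note n = hat_reparametrization_card[OF H]
  show "inj_on (T_map f) {0..1}"
  proof (rule inj_onI)
    fix x y :: real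
    assume xy: "x \<in> {0..1}" "y \<in> {0..1}" and eq: "T_map f x = T_map f y"
    have "\<phi> x \<in> {1..real CARD('n)}" "\<phi> y \<in> {1..real CARD('n)}" using img xy by auto
    moreover have "hat k (\<phi> x) = hat k (\<phi> y)" if "k \<in> {1..CARD('n)}" for k
      using eq T xy hat_curve_nth[OF p that] by metis
    then have "(\<Sum>k\<in>{1..CARD('n)}. real k * hat k (\<phi> x)) = (\<Sum>k\<in>{1..CARD('n)}. real k * hat k (\<phi> y))"
      by (intro sum.cong) auto
    ultimately have "\<phi> x = \<phi> y" using sum_index_hat[OF n] by metis
    then show "x = y" using strict_mono_on_eqD[OF mono] xy by blast
  qed
  have "T_map f ` {0..1} = hat_curve p ` \<phi> ` {0..1}"
    unfolding image_image using T by (intro image_cong) auto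
  then show "hamiltonian_path (T_map f ` {0..1})"
    unfolding hamiltonian_path_def using p hat_curve_image[OF n, of p] img by auto
qed

section \<open>Recovering the reparametrization from a basis or a Hamiltonian path\<close>

lemma pseudo_triangular_imp_hat_reparametrization:
  fixes f :: "'n::finite \<Rightarrow> real \<Rightarrow> real"
  assumes cont: "\<And>i. continuous_on {0..1} (f i)"
    and pt: "pseudo_triangular_basis f"
  shows "\<exists>p \<phi>. hat_reparametrization f p \<phi>"
proof -
  let ?n = "CARD('n)"
  obtain t :: "nat \<Rightarrow> real" and p :: "nat \<Rightarrow> 'n" where t1: "t 1 = 0" and tn: "t ?n = 1"
    and t_mono: "strict_mono_on {1..?n} t" and p: "bij_betw p {1..?n} UNIV"
    and basis: "\<forall>i\<in>{1..<?n}.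
           f (p i) (t i) = 1 \<and> f (p i) (t (i + 1)) = 0 \<and>
           (\<forall>x\<in>{t i..t (i + 1)}. \<forall>j. j \<noteq> p i \<and> j \<noteq> p (i + 1) \<longrightarrow> f j x = 0) \<and>
           (\<forall>x\<in>{t i..t (i + 1)}. f (p (i + 1)) x = 1 - f (p i) x) \<and>
           bij_betw (f (p i)) {t i..t (i + 1)} {0..1} \<and>
           bij_betw (f (p (i + 1))) {t i..t (i + 1)} {0..1}"
    using pt unfolding pseudo_triangular_basis_def by blast
  have val: "f (p i) (t i) = 1"
    and bij: "bij_betw (f (p (i + 1))) {t i..t (i + 1)} {0..1}" if "i \<in> {1..<?n}" for i
    using basis that by blast+
  have other: "f j x = 0" if "i \<in> {1..<?n}" "x \<in> {t i..t (i + 1)}" "j \<noteq> p i" "j \<noteq> p (i + 1)" for i x j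
    using basis that by blast
  have compl: "f (p (i + 1)) x = 1 - f (p i) x" if "i \<in> {1..<?n}" "x \<in> {t i..t (i + 1)}" for i x
    using basis that by blast
  \<comment> \<open>With a single node, \<open>t 1\<close> would have to be both 0 and 1.\<close>
  have "?n \<noteq> 1" using t1 tn by auto
  moreover have "0 < ?n" by simp
  ultimately have n: "1 < ?n" by linarith
  have t_le: "t i \<le> t j" if "i \<in> {1..?n}" "j \<in> {1..?n}" "i \<le> j" for i j
    using strict_mono_on_leD[OF t_mono] that by blast
  have sub: "{t i..t (i + 1)} \<subseteq> {0..1}" if "i \<in> {1..<?n}" for i
    using t_le[of 1 i] t_le[of "i + 1" ?n] that t1 tn n by auto
  have lt: "t i < t (i + 1)" if "i \<in> {1..<?n}" for i
    using strict_mono_onD[OF t_mono, of i "i + 1"] that by auto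
  \<comment> \<open>If the \<open>f (p k)\<close> are hats at a parameter,
    \<open>sum_index_hat\<close> says that this weighted sum is the parameter. One global formula
    thus replaces a definition piece by piece.\<close>
  define \<phi> where "\<phi> x = (\<Sum>k\<in>{1..?n}. real k * f (p k) x)" for x
  \<comment> \<open>On the \<open>i\<close>-th interval the value of the rising function measures
    the progress from node \<open>i\<close> to node \<open>i + 1\<close>, so the parameter is
    \<open>i\<close> plus this value.\<close>
  have fp: "f (p k) x = hat k (real i + f (p (i + 1)) x)"
    if i: "i \<in> {1..<?n}" and x: "x \<in> {t i..t (i + 1)}" and k: "k \<in> {1..?n}" for i x k
  proof -
    have "f (p (i + 1)) x \<in> {0..1}" using bij[OF i] x by (auto simp: bij_betw_def)
    then have y: "real i + f (p (i + 1)) x \<in> {real i..real (i + 1)}" by auto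
    consider "k = i" | "k = i + 1" | "k \<noteq> i" "k \<noteq> i + 1" by blast
    then show ?thesis
    proof cases
      case 1
      then show ?thesis using hat_left_node[OF y] compl[OF i x] by simp
    next
      case 2
      then show ?thesis using hat_right_node[OF y] by simp
    next
      case 3
      then have "p k \<noteq> p i" "p k \<noteq> p (i + 1)"
        using p k i by (auto simp: bij_betw_def dest: inj_onD)
      then show ?thesis using hat_eq_0_between[OF y 3] other[OF i x] by simp
    qed
  qed
  have phi: "\<phi> x = real i + f (p (i + 1)) x"
    if i: "i \<in> {1..<?n}" and x: "x \<in> {t i..t (i + 1)}" for i x
  proof -
    have "0 \<le> f (p (i + 1)) x" "f (p (i + 1)) x \<le> 1" using bij[OF i] x by (auto simp: bij_betw_def)
    moreover have "1 \<le> real i" "real i + 1 \<le> real ?n" using i by auto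
    ultimately have "real i + f (p (i + 1)) x \<in> {1..real ?n}" by auto
    then show ?thesis
      unfolding \<phi>_def using sum_index_hat[OF n] fp[OF i x] by simp
  qed
  have loc: "\<exists>i\<in>{1..<?n}. x \<in> {t i..t (i + 1)}" if "x \<in> {0..1}" for x
  proof -
    have "t 1 \<le> x" "x \<le> t ?n" using that t1 tn by auto
    then show ?thesis using mem_consecutive_interval[OF n] by metis
  qed
  have piece_mono: "strict_mono_on {t i..t (i + 1)} \<phi>" if i: "i \<in> {1..<?n}" for i
  proof -
    let ?g = "f (p (i + 1))"
    have "continuous_on {t i..t (i + 1)} ?g"
      using cont sub[OF i] by (rule continuous_on_subset)
    moreover have "inj_on ?g {t i..t (i + 1)}" using bij[OF i] by (simp add: bij_betw_def)
    \<comment> \<open>A continuous injection on an interval is strictly monotone. The direction is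
      then settled by the left endpoint, where the value is 0, the least possible.\<close>
    ultimately have "strict_mono_on {t i..t (i + 1)} ?g \<or> strict_antimono_on {t i..t (i + 1)} ?g"
      using injective_eq_monotone_map[of "{t i..t (i + 1)}" ?g] by (simp add: is_interval_cc)
    moreover have "\<not> strict_antimono_on {t i..t (i + 1)} ?g"
    proof
      assume "strict_antimono_on {t i..t (i + 1)} ?g"
      then have "?g (t (i + 1)) < ?g (t i)"
        using lt[OF i] by (auto simp: monotone_on_def)
      moreover have "?g (t i) = 0" using compl[OF i, of "t i"] val[OF i] lt[OF i] by auto
      moreover have "0 \<le> ?g (t (i + 1))" using bij[OF i] lt[OF i] by (auto simp: bij_betw_def)
      ultimately show False by simp
    qed
    ultimately show ?thesis
      using phi[OF i] by (auto simp: monotone_on_def)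
  qed
  have mono: "strict_mono_on {0..1} \<phi>"
    using strict_mono_on_pieces[OF n t_mono piece_mono] t1 tn by simp
  have "\<phi> ` {0..1} = {1..real ?n}"
  proof (intro equalityI subsetI)
    fix y assume "y \<in> \<phi> ` {0..1}"
    then obtain x where "x \<in> {0..1}" "y = \<phi> x" by blast
    then obtain i where i: "i \<in> {1..<?n}" "x \<in> {t i..t (i + 1)}" "y = real i + f (p (i + 1)) x"
      using loc phi by metis
    then have "0 \<le> f (p (i + 1)) x" "f (p (i + 1)) x \<le> 1" using bij[OF i(1)] by (auto simp: bij_betw_def)
    moreover have "1 \<le> real i" "real i + 1 \<le> real ?n" using i by auto
    ultimately show "y \<in> {1..real ?n}" using i(3) by auto
  next
    fix y assume y: "y \<in> {1..real ?n}"
    obtain i where i: "i \<in> {1..<?n}" "y \<in> {real i..real (i + 1)}"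
      using mem_node_interval[OF n y] .
    then have "y - real i \<in> f (p (i + 1)) ` {t i..t (i + 1)}"
      using bij[OF i(1)] by (auto simp: bij_betw_def)
    then obtain x where x: "x \<in> {t i..t (i + 1)}" "y - real i = f (p (i + 1)) x" by blast
    then have "y = \<phi> x" using phi[OF i(1) x(1)] by simp
    then show "y \<in> \<phi> ` {0..1}" using x(1) sub[OF i(1)] by blast
  qed
  moreover have "f (p k) x = hat k (\<phi> x)" if "k \<in> {1..?n}" "x \<in> {0..1}" for k x
    using loc[OF that(2)] fp phi that(1) by metis
  ultimately show ?thesis
    using p mono unfolding hat_reparametrization_def by blast
qed

text \<open>The time at which the polygonal curve meets \<open>T_map f x\<close> is a continuous
  injective function of \<open>x\<close>, hence strictly monotone. If it decreases, the path is
  traversed backwards, and reversing the order of the vertices repairs this.\<close>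

lemma hamiltonian_imp_hat_reparametrization:
  fixes f :: "'n::finite \<Rightarrow> real \<Rightarrow> real"
  assumes cont: "\<And>i. continuous_on {0..1} (f i)"
    and inj: "inj_on (T_map f) {0..1}" and path: "hamiltonian_path (T_map f ` {0..1})"
  shows "\<exists>p \<phi>. hat_reparametrization f p \<phi>"
proof -
  let ?n = "CARD('n)"
  obtain p :: "nat \<Rightarrow> 'n" where p: "bij_betw p {1..?n} UNIV"
    and edges: "T_map f ` {0..1} = (\<Union>i\<in>{1..<?n}. convex hull {axis (p i) 1, axis (p (i + 1)) 1})"
    using path unfolding hamiltonian_path_def by blast
  \<comment> \<open>For \<open>n = 1\<close> the union of edges is empty, but the image of
    \<open>[0,1]\<close> is not.\<close>
  have "{1..<?n} \<noteq> {}" using edges by force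
  then have n: "1 < ?n" by simp
  have img: "T_map f ` {0..1} = hat_curve p ` {1..real ?n}"
    using edges hat_curve_image[OF n, of p] by simp
  define \<phi> where "\<phi> x = (\<Sum>k\<in>{1..?n}. real k * f (p k) x)" for x
  have phi_eq: "\<phi> x = y" if "T_map f x = hat_curve p y" "y \<in> {1..real ?n}" for x y
    using that sum_index_hat[OF n] by (simp add: \<phi>_def T_map_eq_hat_curve_iff[OF p])
  have phi: "\<phi> x \<in> {1..real ?n}" "T_map f x = hat_curve p (\<phi> x)" if "x \<in> {0..1}" for x
  proof -
    have "T_map f x \<in> hat_curve p ` {1..real ?n}"
      using that unfolding img[symmetric] by (rule imageI)
    then obtain y where y: "y \<in> {1..real ?n}" "T_map f x = hat_curve p y" by (auto elim!: imageE)
    then show "\<phi> x \<in> {1..real ?n}" "T_map f x = hat_curve p (\<phi> x)"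
      using phi_eq[OF y(2,1)] by simp_all
  qed
  have phi_img: "\<phi> ` {0..1} = {1..real ?n}"
  proof (intro equalityI subsetI)
    fix y assume y: "y \<in> {1..real ?n}"
    then have "hat_curve p y \<in> T_map f ` {0..1}" unfolding img by (rule imageI)
    then obtain x where "x \<in> {0..1}" "T_map f x = hat_curve p y" by (metis imageE)
    then show "y \<in> \<phi> ` {0..1}" using phi_eq[of x y] y by (metis imageI)
  next
    fix y assume "y \<in> \<phi> ` {0..1}"
    then show "y \<in> {1..real ?n}" using phi(1) by (auto simp del: atLeastAtMost_iff)
  qed
  have fp: "f (p k) x = hat k (\<phi> x)" if "k \<in> {1..?n}" "x \<in> {0..1}" for k x
    using phi(2)[OF that(2)] that(1) by (simp add: T_map_eq_hat_curve_iff[OF p])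
  have "inj_on \<phi> {0..1}"
    using inj phi(2) by (metis (no_types, lifting) inj_on_def)
  moreover have "continuous_on {0..1} \<phi>"
    unfolding \<phi>_def by (intro continuous_intros cont)
  ultimately consider "strict_mono_on {0..1} \<phi>" | "strict_antimono_on {0..1} \<phi>"
    using injective_eq_monotone_map[of "{0..1}" \<phi>] by (auto simp: is_interval_cc)
  then show ?thesis
  proof cases
    case 1
    then show ?thesis
      using p phi_img fp unfolding hat_reparametrization_def by blast
  next
    case 2
    \<comment> \<open>The reflection \<open>y \<mapsto> n + 1 - y\<close> of \<open>[1,n]\<close>
      exchanges the hats at \<open>k\<close> and \<open>n + 1 - k\<close>.\<close>
    let ?r = "\<lambda>k. ?n + 1 - k" and ?\<psi> = "\<lambda>x. real ?n + 1 - \<phi> x"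
    have r: "bij_betw ?r {1..?n} {1..?n}"
      by (rule bij_betw_byWitness[where f' = ?r]) auto
    have "bij_betw (p \<circ> ?r) {1..?n} UNIV"
      using bij_betw_trans[OF r p] .
    moreover have "strict_mono_on {0..1} ?\<psi>"
      using 2 by (auto simp: monotone_on_def)
    moreover have "?\<psi> ` {0..1} = (\<lambda>y. real ?n + 1 - y) ` {1..real ?n}"
      unfolding phi_img[symmetric] image_image ..
    then have "?\<psi> ` {0..1} = {1..real ?n}"
      by simp
    moreover have "f ((p \<circ> ?r) k) x = hat k (?\<psi> x)" if k: "k \<in> {1..?n}" and x: "x \<in> {0..1}" for k x
    proof -
      have "real (?r k) = real ?n + 1 - real k" using k by (simp add: of_nat_diff)
      then have "\<bar>\<phi> x - real (?r k)\<bar> = \<bar>?\<psi> x - real k\<bar>" by linarith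
      then have "hat (?r k) (\<phi> x) = hat k (?\<psi> x)" unfolding hat_def by (simp only:)
      moreover have "?r k \<in> {1..?n}" using k by auto
      ultimately show ?thesis using fp[of "?r k" x] x by simp
    qed
    ultimately show ?thesis unfolding hat_reparametrization_def by blast
  qed
qed

section \<open>From min-convexity to a pseudo-triangular basis\<close>

lemma min_convex_between:
  assumes "min_convex g" "x \<in> {0..1}" "y \<in> {0..1}" "x \<le> z" "z \<le> y"
  shows "min (g x) (g y) \<le> g z"
proof -
  have "z \<in> closed_segment x y"
    using assms by (simp add: closed_segment_eq_real_ivl)
  then obtain u where u: "1 - u \<in> {0..1}" and z: "z = (1 - u) * x + u * y"
    by (auto simp: in_segment)
  have "min (g x) (g y) \<le> g ((1 - u) * x + (1 - (1 - u)) * y)"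
    using assms(1-3) u unfolding min_convex_def by blast
  then show ?thesis using z by simp
qed

text \<open>Since the values sum to 1, all other functions vanish at a peak. Min-convexity extends
  this vanishing past the peak, so that between adjacent peaks only two functions remain, and they
  add up to 1.\<close>

lemma convexity_imp_pseudo_triangular:
  fixes f :: "'n::finite \<Rightarrow> real \<Rightarrow> real"
  assumes cont: "\<And>i. continuous_on {0..1} (f i)"
    and range: "\<And>i. f i \<in> {0..1} \<rightarrow> {0..1}"
    and sum1: "ruspini_partition f"
    and normal: "\<And>i. strongly_normal (f i)"
    and convex: "\<And>i. min_convex (f i)"
    and strict: "\<And>i. strictly_min_convex_on_support (f i)"
  shows "pseudo_triangular_basis f"
proof -
  let ?n = "CARD('n)"
  have ge0: "0 \<le> f i x" and le1: "f i x \<le> 1" if "x \<in> {0..1}" for i x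
    using range[of i] that by (auto simp: Pi_iff)
  have ex1: "\<exists>!x. x \<in> {0..1} \<and> f i x = 1" for i
    using normal[of i] by (simp add: strongly_normal_def)
  then have "\<forall>i. \<exists>x. x \<in> {0..1} \<and> f i x = 1" by blast
  then obtain peak where peak: "\<And>i. peak i \<in> {0..1}" "\<And>i. f i (peak i) = 1"
    using choice[of "\<lambda>i x. x \<in> {0..1} \<and> f i x = 1"] by blast
  have peak_unique: "x = peak i" if "x \<in> {0..1}" "f i x = 1" for i x
    using ex1[of i] peak that by blast
  have sum2: "f i x + f j x \<le> 1" if "i \<noteq> j" "x \<in> {0..1}" for i j x
  proof -
    have "(\<Sum>k\<in>{i, j}. f k x) \<le> (\<Sum>k\<in>UNIV. f k x)"
      using ge0[OF that(2)] by (intro sum_mono2) auto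
    then show ?thesis using that sum1 by (simp add: ruspini_partition_def)
  qed
  have zero: "f j (peak i) = 0" if "i \<noteq> j" for i j
    using sum2[OF that peak(1)[of i]] peak(2)[of i] ge0[OF peak(1)[of i], of j] by simp
  \<comment> \<open>Here \<open>peak i\<close> lies between \<open>peak j\<close> and
    \<open>x\<close>. The smaller of 1 and \<open>f j x\<close> is thus at most
    \<open>f j (peak i) = 0\<close>.\<close>
  have zero_right: "f j x = 0" if "peak j < peak i" "peak i \<le> x" "x \<in> {0..1}" for i j x
  proof -
    have "i \<noteq> j" using that(1) by auto
    moreover have "min (f j (peak j)) (f j x) \<le> f j (peak i)"
      using that(1,2) by (intro min_convex_between[OF convex peak(1) that(3)]) auto
    ultimately show ?thesis
      using zero peak(2)[of j] ge0[OF that(3), of j] le1[OF that(3), of j] by simp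
  qed
  have zero_left: "f j x = 0" if "peak i < peak j" "x \<le> peak i" "x \<in> {0..1}" for i j x
  proof -
    have "i \<noteq> j" using that(1) by auto
    moreover have "min (f j x) (f j (peak j)) \<le> f j (peak i)"
      using that(1,2) by (intro min_convex_between[OF convex that(3) peak(1)]) auto
    ultimately show ?thesis
      using zero peak(2)[of j] ge0[OF that(3), of j] le1[OF that(3), of j] by simp
  qed
  \<comment> \<open>At a common peak of two functions, one value would be both 0 and 1.\<close>
  have inj: "inj peak"
  proof (rule injI, rule ccontr)
    fix i j assume "peak i = peak j" "i \<noteq> j"
    then show False using zero[of i j] peak(2)[of j] by simp
  qed
  then have card: "card (range peak) = ?n" by (rule card_image)
  obtain t where t_bij: "bij_betw t {1..?n} (range peak)" and t_mono: "strict_mono_on {1..?n} t"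
    using ex_strict_mono_enumeration[of "range peak"] card by auto
  \<comment> \<open>The map \<open>t\<close> sorts the peak positions; \<open>inv peak\<close> tells
    which function has its peak there.\<close>
  define p where "p = inv peak \<circ> t"
  have p: "bij_betw p {1..?n} UNIV"
    unfolding p_def using t_bij inj_imp_bij_betw_inv[OF inj] by (rule bij_betw_trans)
  have peak_p: "peak (p k) = t k" if "k \<in> {1..?n}" for k
  proof -
    have "t k \<in> range peak" using t_bij that by (auto simp: bij_betw_def)
    then show ?thesis by (simp add: p_def f_inv_into_f)
  qed
  have p_surj: "\<exists>k\<in>{1..?n}. j = p k" for j
    using p by (metis UNIV_I bij_betw_imp_surj_on imageE)
  have t01: "t k \<in> {0..1}" if "k \<in> {1..?n}" for k
    using peak_p[OF that] peak(1) by metis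
  have t_less: "t i < t j" if "i \<in> {1..?n}" "j \<in> {1..?n}" "i < j" for i j
    using strict_mono_onD[OF t_mono] that by blast
  have pos: "0 < ?n" by simp
  have only: "f i x = 1" if "\<And>j. j \<noteq> i \<Longrightarrow> f j x = 0" "x \<in> {0..1}" for i x
  proof -
    have "(\<Sum>k\<in>UNIV. f k x) = (\<Sum>k\<in>{i}. f k x)"
      using that(1) by (intro sum.mono_neutral_right) auto
    then show ?thesis using sum1 that(2) by (simp add: ruspini_partition_def)
  qed
  \<comment> \<open>All functions but the first in the order vanish at 0, because the first peak
    separates 0 from theirs. The first one therefore takes the value 1 at 0, and uniqueness of its
    peak puts \<open>t 1\<close> there. The last node is treated symmetrically.\<close>
  have t1: "t 1 = 0"
  proof -
    have "f (p 1) 0 = 1"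
    proof (rule only)
      fix j assume "j \<noteq> p 1"
      moreover obtain k where k: "k \<in> {1..?n}" "j = p k" using p_surj by blast
      ultimately have "k \<noteq> 1" by auto
      then show "f j 0 = 0"
        using zero_left[of "p 1" j 0] peak_p[of 1] peak_p[OF k(1)] t_less[of 1 k] t01[of 1] k
        by auto
    qed simp
    then show ?thesis using peak_unique[of 0 "p 1"] peak_p[of 1] pos by (simp add: Suc_le_eq)
  qed
  have tn: "t ?n = 1"
  proof -
    have "f (p ?n) 1 = 1"
    proof (rule only)
      fix j assume "j \<noteq> p ?n"
      moreover obtain k where k: "k \<in> {1..?n}" "j = p k" using p_surj by blast
      ultimately have "k \<noteq> ?n" by auto
      then have "k < ?n" using k(1) by simp
      then show "f j 1 = 0"
        using zero_right[of j "p ?n" 1] peak_p[of ?n] peak_p[OF k(1)] t_less[of k ?n] t01[of ?n] k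
        by auto
    qed simp
    then show ?thesis using peak_unique[of 1 "p ?n"] peak_p[of ?n] pos by (simp add: Suc_le_eq)
  qed
  have main: "f (p i) (t i) = 1 \<and> f (p i) (t (i + 1)) = 0 \<and>
           (\<forall>x\<in>{t i..t (i + 1)}. \<forall>j. j \<noteq> p i \<and> j \<noteq> p (i + 1) \<longrightarrow> f j x = 0) \<and>
           (\<forall>x\<in>{t i..t (i + 1)}. f (p (i + 1)) x = 1 - f (p i) x) \<and>
           bij_betw (f (p i)) {t i..t (i + 1)} {0..1} \<and>
           bij_betw (f (p (i + 1))) {t i..t (i + 1)} {0..1}" if i: "i \<in> {1..<?n}" for i
  proof -
    have i1: "i \<in> {1..?n}" "i + 1 \<in> {1..?n}" using i by auto
    let ?I = "{t i..t (i + 1)}" and ?g = "f (p i)" and ?h = "f (p (i + 1))"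
    have lt: "t i < t (i + 1)" using t_less[OF i1] by simp
    have sub: "?I \<subseteq> {0..1}" using t01 i1 by (meson atLeastatMost_subset_iff atLeastAtMost_iff)
    have neq: "p i \<noteq> p (i + 1)" using p i1 by (auto simp: bij_betw_def dest: inj_onD)
    have g1: "?g (t i) = 1" using peak(2) peak_p i1 by metis
    have g0: "?g (t (i + 1)) = 0" using zero[of "p (i + 1)" "p i"] neq peak_p i1 by auto
    have others: "f j x = 0" if x: "x \<in> ?I" and j: "j \<noteq> p i" "j \<noteq> p (i + 1)" for j x
    proof -
      obtain k where k: "k \<in> {1..?n}" "j = p k" using p_surj by blast
      have x01: "x \<in> {0..1}" using x sub by blast
      have "k \<noteq> i" "k \<noteq> i + 1" using j k by auto
      then consider "k < i" | "i + 1 < k" by linarith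
      then show ?thesis
      proof cases
        case 1
        then show ?thesis
          using zero_right[of j "p i" x] peak_p k i1 t_less[OF k(1) i1(1)] x x01 by auto
      next
        case 2
        then show ?thesis
          using zero_left[of "p (i + 1)" j x] peak_p k i1 t_less[OF i1(2) k(1)] x x01 by auto
      qed
    qed
    have compl: "?h x = 1 - ?g x" if x: "x \<in> ?I" for x
    proof -
      have "(\<Sum>k\<in>UNIV. f k x) = (\<Sum>k\<in>{p i, p (i + 1)}. f k x)"
        using others[OF x] by (intro sum.mono_neutral_right) auto
      then show ?thesis using sum1 x sub neq by (auto simp: ruspini_partition_def)
    qed
    \<comment> \<open>The left end \<open>t i\<close> carries the maximal value 1, so the minimum
      over the ends of \<open>[t i, y]\<close> is \<open>?g y\<close>.\<close>
    have decr: "?g y \<le> ?g x" if "x \<in> ?I" "y \<in> ?I" "x \<le> y" for x y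
    proof -
      have "y \<in> {0..1}" using that sub by blast
      then have "min (?g (t i)) (?g y) \<le> ?g x"
        using that t01[OF i1(1)] by (intro min_convex_between[OF convex]) auto
      then show ?thesis using g1 le1[OF \<open>y \<in> {0..1}\<close>, of "p i"] by simp
    qed
    have strict_decr: "?g x \<noteq> ?g y" if xy: "x \<in> ?I" "y \<in> ?I" "x < y" for x y
    proof
      assume eq: "?g x = ?g y"
      have xy01: "x \<in> {0..1}" "y \<in> {0..1}" using xy sub by blast+
      show False
      \<comment> \<open>A common value 0 would make \<open>?h\<close> equal to 1 at two points,
        against strong normality. A positive common value makes \<open>?g\<close> constant on
        \<open>[x,y]\<close> inside its support, which strict min-convexity refutes at the
        midpoint.\<close>
      proof (cases "?g x = 0")
        case True
        then have "?h x = 1" "?h y = 1" using compl xy eq by auto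
        then show False using peak_unique[OF xy01(1)] peak_unique[OF xy01(2)] xy(3) by (metis less_irrefl)
      next
        case False
        have const: "?g z = ?g x" if "z \<in> {x..y}" for z
          using decr[of x z] decr[of z y] that xy eq by auto
        have "z \<in> support01 ?g" if "z \<in> {x..y}" for z
          using const[OF that] False ge0[OF xy01(1), of "p i"] xy01 that by (auto simp: support01_def)
        then have supp: "x < y \<and> {x..y} \<subseteq> support01 ?g" using xy(3) by blast
        have half: "(1/2::real) \<in> {0<..<1}" by simp
        have "min (?g x) (?g y) < ?g (1/2 * x + (1 - 1/2) * y)"
          using strict[of "p i"] xy01 supp half unfolding strictly_min_convex_on_support_def by blast
        moreover have "1/2 * x + (1 - 1/2) * y \<in> {x..y}" using xy(3) by auto
        ultimately show False using const[of "1/2 * x + (1 - 1/2) * y"] eq by simp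
      qed
    qed
    have inj_g: "inj_on ?g ?I"
      by (rule linorder_inj_onI) (use strict_decr in auto)
    have "?g ` ?I = {0..1}"
    proof (intro equalityI subsetI)
      fix c :: real assume "c \<in> {0..1}"
      moreover have "continuous_on ?I ?g" using cont sub by (rule continuous_on_subset)
      ultimately have "\<exists>x. t i \<le> x \<and> x \<le> t (i + 1) \<and> ?g x = c"
        \<comment> \<open>The values 1 and 0 at the two ends give surjectivity by the intermediate
          value theorem for a falling function.\<close>
        using g0 g1 lt by (intro IVT2') auto
      then show "c \<in> ?g ` ?I" by auto
    qed (use sub ge0 le1 in force)
    with inj_g have g_bij: "bij_betw ?g ?I {0..1}" by (simp add: bij_betw_def)
    moreover have "bij_betw ((\<lambda>c. 1 - c) \<circ> ?g) ?I {0..1}"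
      by (rule bij_betw_trans[OF g_bij])
        (rule bij_betw_byWitness[where f' = "\<lambda>c. 1 - c"], auto)
    then have "bij_betw ?h ?I {0..1}"
      using bij_betw_cong[of ?I ?h "(\<lambda>c. 1 - c) \<circ> ?g" "{0..1}"] compl by simp
    ultimately show ?thesis using g1 g0 others compl by blast
  qed
  show ?thesis
    unfolding pseudo_triangular_basis_def
    using t1 tn t_mono p main by (intro exI[of _ t] exI[of _ p]) blast
qed

theorem theoremI:
  fixes f :: "'n::finite \<Rightarrow> real \<Rightarrow> real"
  assumes "\<And>i. continuous_on {0..1} (f i)"
    and "\<And>i. f i \<in> {0..1} \<rightarrow> {0..1}"
  shows
    "(pseudo_triangular_basis f \<longleftrightarrow>
        two_overlapping f \<and> ruspini_partition f \<and>
        (\<forall>i. strongly_normal (f i) \<and> min_convex (f i) \<and> strictly_min_convex_on_support (f i)))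
     \<and>
     (pseudo_triangular_basis f \<longleftrightarrow>
        inj_on (T_map f) {0..1} \<and> hamiltonian_path (T_map f ` {0..1}))"
proof -
  \<comment> \<open>Both equivalences pass through the existence of a reparametrization. Only the
    way back from the convexity conditions leads to a pseudo-triangular basis directly.\<close>
  have reparametrization: "pseudo_triangular_basis f \<longleftrightarrow> (\<exists>p \<phi>. hat_reparametrization f p \<phi>)"
    using pseudo_triangular_imp_hat_reparametrization[of f, OF assms(1)]
      hat_reparametrization_imp_pseudo_triangular[of f] by blast
  have "pseudo_triangular_basis f \<longleftrightarrow>
      two_overlapping f \<and> ruspini_partition f \<and>
      (\<forall>i. strongly_normal (f i) \<and> min_convex (f i) \<and> strictly_min_convex_on_support (f i))"
    using reparametrization hat_reparametrization_imp_two_overlapping[of f]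
      hat_reparametrization_imp_ruspini[of f] hat_reparametrization_imp_convexity[of f]
      convexity_imp_pseudo_triangular[of f, OF assms] by blast
  moreover have "pseudo_triangular_basis f \<longleftrightarrow>
      inj_on (T_map f) {0..1} \<and> hamiltonian_path (T_map f ` {0..1})"
    using reparametrization hat_reparametrization_imp_hamiltonian[of f]
      hamiltonian_imp_hat_reparametrization[of f, OF assms(1)] by blast
  ultimately show ?thesis ..
qed

end
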